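(* Let $\Lambda$ be a real-valued function on $[0,4]$ and suppose that $p_3>2$ is an integer such that $$\sup_{j\in\mathbb{F}_p^\times}\Lambda_{S_j}(\vartheta)\le\Lambda(\vartheta),\qquad 0\le\vartheta\le4,$$ for every prime $p\ge p_3$. Let $\varepsilon>0$. For any odd prime $p$ and any subsets $E,F\subseteq\mathbb{F}_p^4$ with $1\le|F|\le p^\vartheta$ and $|E||F|\ge p^{4+2\Lambda(\vartheta)+\varepsilon}$ for some $0\le\vartheta\le4$, there exists $F'\subseteq F$ such that $|F'|=(1+o_{\varepsilon,p_3}(1))|F|$ and $$|\Delta_y(E)|=(1+o_{\varepsilon,p_3}(1))\,p$$ uniformly for every $y\in F'$.
   Context: For an odd prime $p$, let $\chi(y)=e^{2\pi i y/p}$ on $\mathbb{F}_p$, $Q_4(x)=x_1^2+\dots+x_4^2$, and for $j\in\mathbb{F}_p^\times$ let $S_j=\{x\in\mathbb{F}_p^4:Q_4(x)=j\}$ with uniform probability measure $d\sigma_j$, so $\|f\|_{L^2(S_j,d\sigma_j)}=\big(\frac1{|S_j|}\sum_{\xi\in S_j}|f(\xi)|^2\big)^{1/2}$. Let $(f\,d\sigma_j)^\vee(x)=\frac1{|S_j|}\sum_{y\in S_j}f(y)\chi(y\cdot x)$, and let $L^2(E)$ use counting measure. For $0\le\vartheta\le4$, $\Lambda_{S_j}(\vartheta)$ is the infimum of all $\lambda\ge0$ such that for every $E\subseteq\mathbb{F}_p^4$ with $1\le|E|\le p^\vartheta$ and every $f:S_j\to\mathbb{C}$, $\|(f\,d\sigma_j)^\vee\|_{L^2(E)}\le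 p^\lambda\|f\|_{L^2(S_j,d\sigma_j)}$. For $y\in\mathbb{F}_p^4$, $\Delta_y(E)=\{Q_4(x-y):x\in E\}\subseteq\mathbb{F}_p$. The notation $o_{\varepsilon,p_3}(1)$ denotes a quantity that may depend on $\varepsilon$, $p_3$ and $p$ and tends to $0$ as $p\to\infty$ for fixed $\varepsilon,p_3$; the convergence is uniform over all sets $E,F$ satisfying the hypotheses and over $y\in F'$. *)

theory Defs
  imports "HOL-Analysis.Analysis" "HOL-Number_Theory.Number_Theory"
begin

text \<open>
  The prime \<open>p\<close> varies inside the statement, so the field with \<open>p\<close> elements is not a type:
  its elements are the representatives \<open>{0..<int p}\<close> and arithmetic is done on
  integers, followed by reduction modulo \<open>p\<close>.
\<close>

definition Fp :: "nat \<Rightarrow> int set" where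
  "Fp p = {0..<int p}"

definition Fp_units :: "nat \<Rightarrow> int set" where
  "Fp_units p = Fp p - {0}"

definition Fp4 :: "nat \<Rightarrow> (int ^ 4) set" where
  "Fp4 p = {x. \<forall>i. x $ i \<in> Fp p}"

definition Q4 :: "nat \<Rightarrow> int ^ 4 \<Rightarrow> int" where
  "Q4 p x = (\<Sum>i\<in>UNIV. (x $ i)\<^sup>2) mod int p"

definition dot4 :: "nat \<Rightarrow> int ^ 4 \<Rightarrow> int ^ 4 \<Rightarrow> int" where
  "dot4 p x y = (\<Sum>i\<in>UNIV. x $ i * y $ i) mod int p"

definition chi :: "nat \<Rightarrow> int \<Rightarrow> complex" where
  "chi p y = exp (2 * of_real pi * \<i> * of_int y / of_nat p)"

definition sphere4 :: "nat \<Rightarrow> int \<Rightarrow> (int ^ 4) set" where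
  "sphere4 p j = {x \<in> Fp4 p. Q4 p x = j}"

definition sphere_L2_norm :: "nat \<Rightarrow> int \<Rightarrow> (int ^ 4 \<Rightarrow> complex) \<Rightarrow> real" where
  "sphere_L2_norm p j f =
     sqrt ((1 / real (card (sphere4 p j))) * (\<Sum>\<xi>\<in>sphere4 p j. (cmod (f \<xi>))\<^sup>2))"

definition sphere_ext :: "nat \<Rightarrow> int \<Rightarrow> (int ^ 4 \<Rightarrow> complex) \<Rightarrow> int ^ 4 \<Rightarrow> complex" where
  "sphere_ext p j f x =
     (1 / of_nat (card (sphere4 p j))) * (\<Sum>y\<in>sphere4 p j. f y * chi p (dot4 p y x))"

text \<open>
  A function on the sphere is represented by a total function, of which only the values on
  the sphere matter. \<^const>\<open>L2_set\<close> is the \<open>L\<^sup>2\<close> norm with respect to counting measure.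
\<close>

definition Lambda_S :: "nat \<Rightarrow> int \<Rightarrow> real \<Rightarrow> real" where
  "Lambda_S p j \<theta> = Inf {l :: real. 0 \<le> l \<and>
     (\<forall>E f. E \<subseteq> Fp4 p \<longrightarrow> 1 \<le> card E \<longrightarrow> real (card E) \<le> real p powr \<theta> \<longrightarrow>
        L2_set (\<lambda>x. cmod (sphere_ext p j f x)) E \<le> real p powr l * sphere_L2_norm p j f)}"

definition pinned_dist :: "nat \<Rightarrow> int ^ 4 \<Rightarrow> (int ^ 4) set \<Rightarrow> int set" where
  "pinned_dist p y E = (\<lambda>x. Q4 p (x - y)) ` E"

end

theory Submission
  imports Defs
begin

text \<open>
  Fix a pin \<open>y\<close> and let \<open>\<nu>(t)\<close> be the number of \<open>x \<in> E\<close> with \<open>Q4 p (x - y) = t\<close>. The mean of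
  \<open>\<nu>\<close> over all residues is \<open>card E / p\<close>, and a distance \<open>t\<close> that is not attained deviates from this mean
  by \<open>card E / p\<close>. If the variance of \<open>\<nu>\<close> over the nonzero distances, summed over the
  pins \<open>y \<in> F\<close>, is much smaller than \<open>card F * (card E)\<^sup>2 / p\<close>, then Markov's inequality
  (\<open>card_bad_pins_le\<close>) shows that most pins see almost all distances.

  The variance is computed in frequency space. Four-dimensional Gaussians
  \<open>chi p (s * Q4 p z)\<close> with \<open>s \<noteq> 0\<close> have as Fourier transform the Gaussian with the dual parameter
  \<open>- 1 / (4 s)\<close>, multiplied by a constant that does not depend on \<open>s\<close>
  (\<open>Fourier_transform_chirp\<close>). The distance counts are thereby expressed through the components
  \<open>A\<^sub>r(y)\<close> obtained by restricting the Fourier transform of \<open>E\<close> to the sphere of radius \<open>r\<close> and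
  transforming back (\<open>dist_count_expansion\<close>). Applying Parseval in \<open>t\<close> and in the dual parameter gives,
  up to a factor \<open>2\<close>, the bound
  \<open>p\<^sup>-\<^sup>5 |A\<^sub>0(y)|\<^sup>2 + p\<^sup>-\<^sup>4 \<Sum>r\<noteq>0. |A\<^sub>r(y)|\<^sup>2\<close>
  for the variance at \<open>y\<close> (\<open>dist_count_variance_le\<close>).

  For \<open>r \<noteq> 0\<close> the function \<open>A\<^sub>r\<close> is, up to the cardinality of the sphere, the extension
  operator applied to the Fourier transform of \<open>E\<close>, so the restriction hypothesis with the set
  \<open>F\<close> controls its square mean over \<open>F\<close>. The cone \<open>r = 0\<close> is not covered by that hypothesis; it
  is harmless because of the additional factor \<open>1 / p\<close>, which comes from excluding \<open>t = 0\<close>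
  and makes plain Parseval over all \<open>y\<close> sufficient. Together the summed variance is at
  most \<open>4 p powr (3 + 2 L) * card E\<close> (\<open>sum_dist_count_variance_le\<close>), where \<open>L\<close> is an upper bound of the
  restriction exponents, and the size hypothesis
  \<open>card E * card F \<ge> p powr (4 + 2 L + \<epsilon>)\<close> makes this smaller than what is needed by a factor
  of order \<open>p powr \<epsilon>\<close>.
\<close>

section \<open>Additive characters and orthogonality\<close>

lemma chi_cis: "chi p y = cis (2 * pi * of_int y / of_nat p)"
  unfolding chi_def cis_conv_exp by (simp add: mult_ac)

lemma chi_0 [simp]: "chi p 0 = 1"
  by (simp add: chi_cis)

lemma chi_add: "chi p (a + b) = chi p a * chi p b"
  by (simp add: chi_cis cis_mult ring_distribs add_divide_distrib)

lemma cmod_chi [simp]: "cmod (chi p a) = 1"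
  by (simp add: chi_cis)

lemma cnj_chi: "cnj (chi p a) = chi p (- a)"
  by (simp add: chi_cis cis_cnj)

lemma chi_sum: "chi p (sum f A) = (\<Prod>i\<in>A. chi p (f i))"
  by (induction A rule: infinite_finite_induct) (auto simp: chi_add)

lemma chi_eq_1_iff:
  assumes "p > 0"
  shows "chi p a = 1 \<longleftrightarrow> int p dvd a"
proof
  assume "chi p a = 1"
  then obtain n :: int where "2 * pi * of_int a / of_nat p = 2 * pi * of_int n"
    unfolding chi_def exp_eq_1 by (auto simp: mult_ac)
  then have "real_of_int a = real_of_int (int p * n)"
    using assms by (simp add: field_simps)
  then have "a = int p * n" by linarith
  then show "int p dvd a" by simp
next
  assume "int p dvd a"
  then obtain n where "a = int p * n" by (elim dvdE)
  then have "2 * pi * of_int a / of_nat p = 2 * pi * of_int n"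
    using assms by simp
  then show "chi p a = 1" by (simp add: chi_cis)
qed

lemma chi_cong:
  assumes "p > 0" "[a = b] (mod int p)"
  shows "chi p a = chi p b"
proof -
  have "chi p a = chi p (a - b) * chi p b" by (simp flip: chi_add)
  then show ?thesis using assms by (simp add: chi_eq_1_iff cong_iff_dvd_diff)
qed

lemma finite_Fp [simp]: "finite (Fp p)" and card_Fp [simp]: "card (Fp p) = p"
  by (auto simp: Fp_def)

lemma finite_Fp_units [simp]: "finite (Fp_units p)"
  by (simp add: Fp_units_def)

lemma Fp_eqI: "x \<in> Fp p \<Longrightarrow> y \<in> Fp p \<Longrightarrow> [x = y] (mod int p) \<Longrightarrow> x = y"
  by (auto simp: Fp_def cong_def)

lemma mod_in_Fp: "p > 0 \<Longrightarrow> x mod int p \<in> Fp p"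
  by (simp add: Fp_def)

lemma Fp_units_not_dvd: "x \<in> Fp_units p \<Longrightarrow> \<not> int p dvd x"
  using zdvd_imp_le by (fastforce simp: Fp_units_def Fp_def)

lemma sum_Fp_shift:
  fixes f :: "int \<Rightarrow> complex"
  assumes p: "p > 0" and f: "\<And>x y. [x = y] (mod int p) \<Longrightarrow> f x = f y"
  shows "(\<Sum>x\<in>Fp p. f (x + b)) = (\<Sum>x\<in>Fp p. f x)"
proof (rule sum.reindex_bij_witness[where i = "\<lambda>x. (x - b) mod int p"
        and j = "\<lambda>x. (x + b) mod int p"])
  fix x assume "x \<in> Fp p"
  then show "((x + b) mod int p - b) mod int p = x" "((x - b) mod int p + b) mod int p = x"
    by (auto simp: Fp_def mod_simps)
  show "f ((x + b) mod int p) = f (x + b)" by (rule f) simp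
qed (auto simp: mod_in_Fp p)

text \<open>
  Replacing \<open>x\<close> by \<open>x + 1\<close> multiplies the sum by \<open>chi p a\<close> and does not change it,
  so it vanishes as soon as \<open>chi p a \<noteq> 1\<close>.
\<close>

lemma sum_Fp_chi:
  assumes p: "p > 0"
  shows "(\<Sum>x\<in>Fp p. chi p (x * a)) = (if int p dvd a then of_nat p else 0)"
proof (cases "int p dvd a")
  case True
  then have "chi p (x * a) = 1" for x using p by (simp add: chi_eq_1_iff)
  then show ?thesis using True by simp
next
  case False
  let ?S = "\<Sum>x\<in>Fp p. chi p (x * a)"
  have "(\<Sum>x\<in>Fp p. chi p ((x + 1) * a)) = ?S"
    by (rule sum_Fp_shift[OF p]) (intro chi_cong[OF p] cong_mult cong_refl)
  also have "(\<Sum>x\<in>Fp p. chi p ((x + 1) * a)) = chi p a * ?S"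
    by (simp add: ring_distribs chi_add sum_distrib_left mult_ac)
  finally have "(chi p a - 1) * ?S = 0" by (simp add: algebra_simps)
  then show ?thesis using False p by (simp add: chi_eq_1_iff)
qed

lemma sum_Fp_chi_orthogonal:
  assumes "p > 0" "x \<in> Fp p" "x' \<in> Fp p"
  shows "(\<Sum>y\<in>Fp p. chi p (y * (x - x'))) = (if x = x' then of_nat p else 0)"
  using assms Fp_eqI[of x p x'] by (auto simp: sum_Fp_chi cong_iff_dvd_diff)

text \<open>
  Parseval's identity for an arbitrary finite orthogonal system. It is applied to systems
  indexed by the points of a set, by the frequencies on a sphere, by the radii of the spheres
  and by the frequencies dual to distances, so the index set \<open>X\<close> of the system and the domain
  \<open>Y\<close> of its members are kept apart.
\<close>

lemma sum_cmod_square_orthogonal: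
  fixes \<phi> :: "'a \<Rightarrow> 'b \<Rightarrow> complex" and N :: real
  assumes orth: "\<And>x x'. x \<in> X \<Longrightarrow> x' \<in> X \<Longrightarrow>
      (\<Sum>y\<in>Y. \<phi> x y * cnj (\<phi> x' y)) = (if x = x' then of_real N else 0)"
    and "finite X"
  shows "(\<Sum>y\<in>Y. (cmod (\<Sum>x\<in>X. a x * \<phi> x y))\<^sup>2) = N * (\<Sum>x\<in>X. (cmod (a x))\<^sup>2)"
proof -
  have "complex_of_real (\<Sum>y\<in>Y. (cmod (\<Sum>x\<in>X. a x * \<phi> x y))\<^sup>2)
      = (\<Sum>y\<in>Y. \<Sum>x\<in>X. \<Sum>x'\<in>X. a x * cnj (a x') * (\<phi> x y * cnj (\<phi> x' y)))"
    by (simp only: of_real_sum complex_norm_square cnj_sum complex_cnj_mult sum_product mult_ac)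
  also have "\<dots> = (\<Sum>x\<in>X. \<Sum>x'\<in>X. \<Sum>y\<in>Y. a x * cnj (a x') * (\<phi> x y * cnj (\<phi> x' y)))"
    by (subst sum.swap, intro sum.cong refl, subst sum.swap, rule refl)
  also have "\<dots> = (\<Sum>x\<in>X. \<Sum>x'\<in>X. a x * cnj (a x') * (if x = x' then of_real N else 0))"
    by (intro sum.cong refl) (simp add: orth flip: sum_distrib_left)
  also have "\<dots> = (\<Sum>x\<in>X. a x * cnj (a x) * of_real N)"
    using \<open>finite X\<close> by (intro sum.cong refl) (simp add: if_distrib sum.delta cong: if_cong)
  also have "\<dots> = complex_of_real (N * (\<Sum>x\<in>X. (cmod (a x))\<^sup>2))"
    unfolding of_real_mult of_real_sum complex_norm_square sum_distrib_left by (simp add: mult_ac)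
  finally show ?thesis by (simp only: of_real_eq_iff)
qed

section \<open>Sums over the four-dimensional space\<close>

text \<open>
  Both the characters and the Gaussians \<open>chi p (u * Q4 p x)\<close> factor over the coordinates.
  This identity therefore reduces every complete sum over four-dimensional space to
  one-dimensional sums.
\<close>

lemma sum_Fp4_prod:
  fixes f :: "4 \<Rightarrow> int \<Rightarrow> 'a::comm_semiring_1"
  shows "(\<Sum>x\<in>Fp4 p. \<Prod>i\<in>UNIV. f i (x $ i)) = (\<Prod>i\<in>UNIV. \<Sum>x\<in>Fp p. f i x)"
proof -
  have "(\<Prod>i\<in>UNIV. \<Sum>x\<in>Fp p. f i x) = (\<Sum>g\<in>PiE UNIV (\<lambda>_. Fp p). \<Prod>i\<in>UNIV. f i (g i))"
    by (rule prod_sum_PiE) auto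
  also have "\<dots> = (\<Sum>x\<in>Fp4 p. \<Prod>i\<in>UNIV. f i (x $ i))"
    by (rule sum.reindex_bij_witness[where i = "\<lambda>x i. x $ i" and j = "\<lambda>g. \<chi> i. g i"])
       (auto simp: Fp4_def)
  finally show ?thesis by simp
qed

lemma finite_Fp4 [simp]: "finite (Fp4 p)" and card_Fp4: "card (Fp4 p) = p ^ 4"
proof -
  have bij: "bij_betw (\<lambda>g. \<chi> i. g i) (PiE UNIV (\<lambda>_::4. Fp p)) (Fp4 p)"
    by (rule bij_betwI[where g = "\<lambda>x i. x $ i"]) (auto simp: Fp4_def)
  have "finite (PiE UNIV (\<lambda>_::4. Fp p))" by (rule finite_PiE) auto
  then show "finite (Fp4 p)" using bij bij_betw_finite by blast
  show "card (Fp4 p) = p ^ 4"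
    using bij_betw_same_card[OF bij] by (simp add: card_PiE)
qed

lemma finite_sphere4 [simp]: "finite (sphere4 p r)"
  by (simp add: sphere4_def)

lemma chi_dot4: "p > 0 \<Longrightarrow> chi p (dot4 p x y) = (\<Prod>i\<in>UNIV. chi p (x $ i * y $ i))"
  unfolding dot4_def chi_sum[symmetric] by (rule chi_cong) auto

lemma chi_Q4: "p > 0 \<Longrightarrow> chi p (u * Q4 p x) = (\<Prod>i\<in>UNIV. chi p (u * (x $ i)\<^sup>2))"
  unfolding Q4_def chi_sum[symmetric]
  by (rule chi_cong) (auto simp: cong_def mod_simps sum_distrib_left)

lemma chi_dot4_add_right: "p > 0 \<Longrightarrow> chi p (dot4 p x (y + z)) = chi p (dot4 p x y) * chi p (dot4 p x z)"
  by (simp add: chi_dot4 ring_distribs chi_add prod.distrib)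

lemma chi_dot4_minus_right: "p > 0 \<Longrightarrow> chi p (dot4 p x (- y)) = cnj (chi p (dot4 p x y))"
  by (simp add: chi_dot4 cnj_chi)

lemma dot4_commute: "dot4 p x y = dot4 p y x"
  by (simp add: dot4_def mult.commute)

lemma sum_Fp4_chi_orthogonal:
  assumes p: "p > 0" and x: "x \<in> Fp4 p" and x': "x' \<in> Fp4 p"
  shows "(\<Sum>y\<in>Fp4 p. chi p (dot4 p x y) * cnj (chi p (dot4 p x' y)))
    = (if x = x' then of_real (real p ^ 4) else 0)"
proof -
  have "(\<Sum>y\<in>Fp4 p. chi p (dot4 p x y) * cnj (chi p (dot4 p x' y)))
      = (\<Sum>y\<in>Fp4 p. \<Prod>i\<in>UNIV. chi p (y $ i * (x $ i - x' $ i)))"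
    by (simp add: chi_dot4[OF p] cnj_chi flip: prod.distrib chi_add) (simp add: algebra_simps)
  also have "\<dots> = (\<Prod>i\<in>UNIV. \<Sum>y\<in>Fp p. chi p (y * (x $ i - x' $ i)))"
    by (rule sum_Fp4_prod)
  also have "\<dots> = (\<Prod>i\<in>UNIV. if x $ i = x' $ i then of_nat p else 0)"
    using x x' by (intro prod.cong refl sum_Fp_chi_orthogonal p) (auto simp: Fp4_def)
  also have "\<dots> = (if x = x' then of_real (real p ^ 4) else 0)"
    by (auto simp: vec_eq_iff)
  finally show ?thesis .
qed

section \<open>Gauss sums\<close>

text \<open>
  The sets of residues \<open>x\<^sup>2\<close> and \<open>- 1 - y\<^sup>2\<close> each have \<open>(p + 1) / 2\<close> elements, one more in
  total than there are residues, so they meet.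
\<close>

lemma exists_sum_two_squares_minus_one:
  assumes "prime p" "odd p"
  shows "\<exists>a b :: int. [a\<^sup>2 + b\<^sup>2 = - 1] (mod int p)"
proof -
  have p: "p > 0" using assms prime_gt_0_nat by blast
  \<comment> \<open>Squaring is injective modulo \<open>p\<close> on this half system of residues.\<close>
  define H where "H = {0..(int p - 1) div 2}"
  have cardH: "2 * card H = p + 1"
    using \<open>odd p\<close> p unfolding H_def by (auto elim!: oddE)
  have inj: "x = y" if "x \<in> H" "y \<in> H" "[x\<^sup>2 = y\<^sup>2] (mod int p)" for x y
  proof -
    have "int p dvd (x - y) * (x + y)"
      using that(3) by (simp add: cong_iff_dvd_diff power2_eq_square algebra_simps)
    then have "int p dvd x - y \<or> int p dvd x + y"
      using \<open>prime p\<close> prime_dvd_mult_iff[of "int p"] by simp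
    moreover have "\<bar>x - y\<bar> < int p" "0 \<le> x + y" "x + y < int p"
      using that p unfolding H_def by auto
    ultimately show ?thesis
      using that(1,2) zdvd_not_zless[of "x + y" "int p"] dvd_imp_le_int[of "x - y" "int p"] unfolding H_def
      by (smt (verit) atLeastAtMost_iff zdvd_not_zless)
  qed
  define f where "f x = x\<^sup>2 mod int p" for x
  define g where "g x = (- 1 - x\<^sup>2) mod int p" for x
  have "inj_on f H" using inj by (auto simp: inj_on_def f_def cong_def)
  moreover have "inj_on g H"
  proof (rule inj_onI)
    fix x y assume xy: "x \<in> H" "y \<in> H" "g x = g y"
    then have "[- 1 - x\<^sup>2 = - 1 - y\<^sup>2] (mod int p)" by (simp add: g_def cong_def)
    then have "[x\<^sup>2 = y\<^sup>2] (mod int p)" by (simp add: cong_iff_dvd_diff dvd_diff_commute)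
    then show "x = y" using inj xy by blast
  qed
  ultimately have card: "card (f ` H) + card (g ` H) > card (Fp p)"
    using cardH by (simp add: card_image)
  have "f ` H \<inter> g ` H \<noteq> {}"
  proof
    assume "f ` H \<inter> g ` H = {}"
    then have "card (f ` H \<union> g ` H) = card (f ` H) + card (g ` H)"
      by (intro card_Un_disjoint) (auto simp: H_def)
    moreover have "card (f ` H \<union> g ` H) \<le> card (Fp p)"
      by (rule card_mono) (auto simp: f_def g_def mod_in_Fp p)
    ultimately show False using card by simp
  qed
  then obtain x y where "f x = g y" by auto
  then have "[x\<^sup>2 = - 1 - y\<^sup>2] (mod int p)" by (simp add: f_def g_def cong_def)
  then have "[x\<^sup>2 + y\<^sup>2 = - 1] (mod int p)" by (simp add: cong_iff_dvd_diff algebra_simps)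
  then show ?thesis by blast
qed

definition gauss_sum :: "nat \<Rightarrow> int \<Rightarrow> complex" where
  "gauss_sum p u = (\<Sum>x\<in>Fp p. chi p (u * x\<^sup>2))"

text \<open>
  The substitution \<open>x = h + y\<close> turns \<open>x\<^sup>2 - y\<^sup>2\<close> into \<open>h\<^sup>2 + 2 h y\<close>, which is linear in
  \<open>y\<close>; summing over \<open>y\<close> leaves only \<open>h = 0\<close>.
\<close>

lemma gauss_sum_mult_minus:
  assumes "prime p" "odd p" and u: "\<not> int p dvd u"
  shows "gauss_sum p u * gauss_sum p (- u) = of_nat p"
proof -
  have p: "p > 0" using assms prime_gt_0_nat by blast
  have dvd: "int p dvd 2 * u * h \<longleftrightarrow> h = 0" if "h \<in> Fp p" for h
  proof -
    have "\<not> int p dvd 2" using \<open>prime p\<close> \<open>odd p\<close>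
      by (metis int_dvd_int_iff of_nat_numeral primes_dvd_imp_eq two_is_prime_nat dvd_refl)
    then have "int p dvd 2 * u * h \<longleftrightarrow> int p dvd h"
      using \<open>prime p\<close> u by (simp add: prime_dvd_mult_iff)
    also have "\<dots> \<longleftrightarrow> h = 0" using Fp_units_not_dvd[of h p] that by (auto simp: Fp_units_def)
    finally show ?thesis .
  qed
  have "gauss_sum p u * gauss_sum p (- u) = (\<Sum>y\<in>Fp p. \<Sum>x\<in>Fp p. chi p (u * x\<^sup>2 - u * y\<^sup>2))"
    unfolding gauss_sum_def by (subst sum.swap) (simp add: sum_product flip: chi_add)
  also have "\<dots> = (\<Sum>y\<in>Fp p. \<Sum>h\<in>Fp p. chi p (u * (h + y)\<^sup>2 - u * y\<^sup>2))"
    by (intro sum.cong refl sum_Fp_shift[OF p, symmetric] chi_cong[OF p] cong_diff cong_mult cong_pow) auto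
  also have "\<dots> = (\<Sum>h\<in>Fp p. chi p (u * h\<^sup>2) * (\<Sum>y\<in>Fp p. chi p (y * (2 * u * h))))"
    by (subst sum.swap, unfold sum_distrib_left, intro sum.cong refl)
       (simp add: power2_eq_square algebra_simps flip: chi_add)
  also have "\<dots> = (\<Sum>h\<in>Fp p. if h = 0 then of_nat p else 0)"
    by (intro sum.cong refl) (simp add: sum_Fp_chi p dvd)
  also have "\<dots> = of_nat p" using p by (simp add: Fp_def)
  finally show ?thesis .
qed

text \<open>
  The square of the Gauss sum is the exponential sum of the form \<open>x\<^sup>2 + y\<^sup>2\<close>. Multiplying
  \<open>x + i y\<close> by \<open>a + i b\<close>, where \<open>a\<^sup>2 + b\<^sup>2 = - 1\<close>, is a bijection of the plane over the field
  that changes the sign of this form.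
\<close>

lemma gauss_sum_minus_square:
  assumes "prime p" "odd p"
  shows "(gauss_sum p (- u))\<^sup>2 = (gauss_sum p u)\<^sup>2"
proof -
  have p: "p > 0" using assms prime_gt_0_nat by blast
  obtain a b :: int where ab: "[a\<^sup>2 + b\<^sup>2 = - 1] (mod int p)"
    using exists_sum_two_squares_minus_one assms by blast
  define m where "m = (\<lambda>(x, y). ((a * x - b * y) mod int p, (b * x + a * y) mod int p))"
  have square: "(gauss_sum p v)\<^sup>2 = (\<Sum>(x, y)\<in>Fp p \<times> Fp p. chi p (v * (x\<^sup>2 + y\<^sup>2)))" for v
    unfolding gauss_sum_def power2_eq_square[of "sum _ _"] sum_product sum.cartesian_product
    by (simp add: ring_distribs chi_add)
  have inj: "inj_on m (Fp p \<times> Fp p)"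
  proof (rule inj_onI, clarify)
    fix x y x' y'
    assume in_Fp: "x \<in> Fp p" "y \<in> Fp p" "x' \<in> Fp p" "y' \<in> Fp p" and "m (x, y) = m (x', y')"
    then have eq: "[a * x - b * y = a * x' - b * y'] (mod int p)"
      "[b * x + a * y = b * x' + a * y'] (mod int p)"
      by (simp_all add: m_def cong_def)
    \<comment> \<open>Multiplication by the conjugate \<open>a - i b\<close> recovers \<open>- (x + i y)\<close>.\<close>
    have "[a * (a * x - b * y) + b * (b * x + a * y) = a * (a * x' - b * y') + b * (b * x' + a * y')] (mod int p)"
      by (intro cong_add cong_mult cong_refl eq)
    then have "[(a\<^sup>2 + b\<^sup>2) * x = (a\<^sup>2 + b\<^sup>2) * x'] (mod int p)"
      by (simp add: power2_eq_square algebra_simps)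
    moreover have "[a * (b * x + a * y) - b * (a * x - b * y) = a * (b * x' + a * y') - b * (a * x' - b * y')] (mod int p)"
      by (intro cong_diff cong_mult cong_refl eq)
    then have "[(a\<^sup>2 + b\<^sup>2) * y = (a\<^sup>2 + b\<^sup>2) * y'] (mod int p)"
      by (simp add: power2_eq_square algebra_simps)
    moreover have "[(a\<^sup>2 + b\<^sup>2) * z = - 1 * z] (mod int p)" for z
      by (intro cong_mult ab cong_refl)
    ultimately have "[- 1 * x = - 1 * x'] (mod int p)" "[- 1 * y = - 1 * y'] (mod int p)"
      by (meson cong_sym cong_trans)+
    then show "x = x' \<and> y = y'"
      using in_Fp by (auto intro!: Fp_eqI simp: cong_minus_minus_iff)
  qed
  have img: "m ` (Fp p \<times> Fp p) = Fp p \<times> Fp p"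
    by (rule endo_inj_surj[OF _ _ inj]) (auto simp: m_def mod_in_Fp p)
  have "(gauss_sum p u)\<^sup>2 = (\<Sum>(x, y)\<in>m ` (Fp p \<times> Fp p). chi p (u * (x\<^sup>2 + y\<^sup>2)))"
    by (simp add: square img)
  also have "\<dots> = (\<Sum>(x, y)\<in>Fp p \<times> Fp p. chi p (- u * (x\<^sup>2 + y\<^sup>2)))"
    unfolding sum.reindex[OF inj]
  proof (intro sum.cong refl, clarsimp simp: m_def)
    fix x y
    have "[u * (((a * x - b * y) mod int p)\<^sup>2 + ((b * x + a * y) mod int p)\<^sup>2)
        = u * ((a * x - b * y)\<^sup>2 + (b * x + a * y)\<^sup>2)] (mod int p)"
      by (intro cong_mult cong_add cong_pow) auto
    also have "u * ((a * x - b * y)\<^sup>2 + (b * x + a * y)\<^sup>2) = (a\<^sup>2 + b\<^sup>2) * (u * (x\<^sup>2 + y\<^sup>2))"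
      by (simp add: power2_eq_square algebra_simps)
    also have "[(a\<^sup>2 + b\<^sup>2) * (u * (x\<^sup>2 + y\<^sup>2)) = - 1 * (u * (x\<^sup>2 + y\<^sup>2))] (mod int p)"
      by (intro cong_mult ab cong_refl)
    finally show "chi p (u * (((a * x - b * y) mod int p)\<^sup>2 + ((b * x + a * y) mod int p)\<^sup>2))
        = chi p (- (u * (x\<^sup>2 + y\<^sup>2)))"
      using p by (auto intro: chi_cong)
  qed
  also have "\<dots> = (gauss_sum p (- u))\<^sup>2" by (simp add: square)
  finally show ?thesis by simp
qed

text \<open>
  In dimension four the quadratic character in the Gauss sum disappears: the value does not
  depend on \<open>u\<close>. This is what makes the contribution of the isotropic cone to
  \<open>dist_count_expansion\<close> a Ramanujan sum, equal to \<open>- 1\<close>, and not a sum twisted by the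
  quadratic character, which would have size \<open>sqrt p\<close>.
\<close>

lemma gauss_sum_power4:
  assumes "prime p" "odd p" "\<not> int p dvd u"
  shows "gauss_sum p u ^ 4 = of_nat p ^ 2"
proof -
  have "gauss_sum p u ^ 4 = (gauss_sum p u)\<^sup>2 * (gauss_sum p (- u))\<^sup>2"
    unfolding gauss_sum_minus_square[OF assms(1,2)] by (simp flip: power_add)
  also have "\<dots> = of_nat p ^ 2"
    using gauss_sum_mult_minus[OF assms] by (simp flip: power_mult_distrib)
  finally show ?thesis .
qed

text \<open>
  Since \<open>4 u s = - 1\<close>, completing the square gives \<open>u x\<^sup>2 + x z = u (x - 2 s z)\<^sup>2 + s z\<^sup>2\<close>.
\<close>

lemma sum_Fp_complete_square:
  assumes p: "p > 0" and us: "[4 * u * s = - 1] (mod int p)"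
  shows "(\<Sum>x\<in>Fp p. chi p (u * x\<^sup>2 + x * z)) = gauss_sum p u * chi p (s * z\<^sup>2)"
proof -
  have "chi p (u * x\<^sup>2 + x * z) = chi p (u * (x + - 2 * s * z)\<^sup>2) * chi p (s * z\<^sup>2)" for x
  proof -
    have "[- 1 * (x * z - s * z\<^sup>2) = 4 * u * s * (x * z - s * z\<^sup>2)] (mod int p)"
      by (intro cong_mult cong_refl cong_sym[OF us])
    then have "[u * x\<^sup>2 + x * z = u * (x + - 2 * s * z)\<^sup>2 + s * z\<^sup>2] (mod int p)"
      by (simp add: cong_iff_dvd_diff power2_eq_square algebra_simps dvd_diff_commute)
    then show ?thesis using p by (auto intro: chi_cong simp flip: chi_add)
  qed
  then have "(\<Sum>x\<in>Fp p. chi p (u * x\<^sup>2 + x * z))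
      = (\<Sum>x\<in>Fp p. chi p (u * (x + - 2 * s * z)\<^sup>2)) * chi p (s * z\<^sup>2)"
    by (simp add: sum_distrib_right)
  also have "(\<Sum>x\<in>Fp p. chi p (u * (x + - 2 * s * z)\<^sup>2)) = gauss_sum p u"
    unfolding gauss_sum_def
    by (rule sum_Fp_shift[OF p]) (auto intro!: chi_cong[OF p] cong_mult cong_pow)
  finally show ?thesis .
qed

text \<open>
  The Fourier transform of a Gaussian with parameter \<open>u\<close> is a Gaussian with the dual
  parameter \<open>s = - 1 / (4 u)\<close>. Read from right to left, this rewrites a function of the distance
  \<open>Q4 p z\<close> as a superposition of characters whose coefficients depend only on the sphere that
  contains the frequency; this is how distances become linked to extension operators
  for spheres.
\<close>

lemma Fourier_transform_chirp:
  assumes "prime p" "odd p" and us: "[4 * u * s = - 1] (mod int p)"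
  shows "(\<Sum>\<xi>\<in>Fp4 p. chi p (u * Q4 p \<xi>) * chi p (dot4 p \<xi> z)) = of_nat p ^ 2 * chi p (s * Q4 p z)"
proof -
  have p: "p > 0" using assms prime_gt_0_nat by blast
  have "\<not> int p dvd u"
  proof
    assume "int p dvd u"
    then have "int p dvd 4 * u * s" by simp
    then have "int p dvd - 1" using us by (metis cong_dvd_iff)
    then show False using \<open>prime p\<close> by (simp add: prime_nat_iff)
  qed
  have "(\<Sum>\<xi>\<in>Fp4 p. chi p (u * Q4 p \<xi>) * chi p (dot4 p \<xi> z))
      = (\<Sum>\<xi>\<in>Fp4 p. \<Prod>i\<in>UNIV. chi p (u * (\<xi> $ i)\<^sup>2 + \<xi> $ i * z $ i))"
    by (simp add: chi_Q4 chi_dot4 p chi_add prod.distrib)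
  also have "\<dots> = (\<Prod>i\<in>UNIV. \<Sum>x\<in>Fp p. chi p (u * x\<^sup>2 + x * z $ i))"
    by (rule sum_Fp4_prod)
  also have "\<dots> = gauss_sum p u ^ 4 * chi p (s * Q4 p z)"
    by (simp add: sum_Fp_complete_square[OF p us] chi_Q4[OF p] prod.distrib)
  finally show ?thesis using gauss_sum_power4[OF assms(1,2) \<open>\<not> int p dvd u\<close>] by simp
qed

section \<open>Spherical components of the Fourier transform of a set\<close>

definition fourier4 :: "nat \<Rightarrow> (int ^ 4) set \<Rightarrow> int ^ 4 \<Rightarrow> complex" where
  "fourier4 p E \<xi> = (\<Sum>x\<in>E. cnj (chi p (dot4 p \<xi> x)))"

definition sphere_component :: "nat \<Rightarrow> (int ^ 4) set \<Rightarrow> int \<Rightarrow> int ^ 4 \<Rightarrow> complex" where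
  "sphere_component p E r y = (\<Sum>\<xi>\<in>sphere4 p r. fourier4 p E \<xi> * chi p (dot4 p \<xi> y))"

definition dist_count :: "nat \<Rightarrow> (int ^ 4) set \<Rightarrow> int ^ 4 \<Rightarrow> int \<Rightarrow> nat" where
  "dist_count p E y t = card {x \<in> E. Q4 p (x - y) = t}"

lemma sum_cmod_fourier4_square:
  assumes p: "p > 0" and E: "E \<subseteq> Fp4 p"
  shows "(\<Sum>\<xi>\<in>Fp4 p. (cmod (fourier4 p E \<xi>))\<^sup>2) = real p ^ 4 * real (card E)"
proof -
  have "(\<Sum>\<xi>\<in>Fp4 p. (cmod (\<Sum>x\<in>E. 1 * cnj (chi p (dot4 p \<xi> x))))\<^sup>2)
      = real p ^ 4 * (\<Sum>x\<in>E. (cmod 1)\<^sup>2)"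
  proof (rule sum_cmod_square_orthogonal)
    fix x x' assume "x \<in> E" "x' \<in> E"
    then have "(\<Sum>\<xi>\<in>Fp4 p. chi p (dot4 p x' \<xi>) * cnj (chi p (dot4 p x \<xi>)))
        = (if x' = x then of_real (real p ^ 4) else 0)"
      using E by (intro sum_Fp4_chi_orthogonal p) auto
    then show "(\<Sum>\<xi>\<in>Fp4 p. cnj (chi p (dot4 p \<xi> x)) * cnj (cnj (chi p (dot4 p \<xi> x'))))
        = (if x = x' then of_real (real p ^ 4) else 0)"
      by (simp add: dot4_commute[of p _ x] dot4_commute[of p _ x'] mult.commute eq_commute)
  qed (rule finite_subset[OF E finite_Fp4])
  then show ?thesis by (simp add: fourier4_def)
qed

lemma sum_cmod_sphere_component_square:
  assumes p: "p > 0"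
  shows "(\<Sum>y\<in>Fp4 p. (cmod (sphere_component p E r y))\<^sup>2)
    = real p ^ 4 * (\<Sum>\<xi>\<in>sphere4 p r. (cmod (fourier4 p E \<xi>))\<^sup>2)"
  unfolding sphere_component_def
proof (rule sum_cmod_square_orthogonal)
  fix \<xi> \<xi>' assume "\<xi> \<in> sphere4 p r" "\<xi>' \<in> sphere4 p r"
  then show "(\<Sum>y\<in>Fp4 p. chi p (dot4 p \<xi> y) * cnj (chi p (dot4 p \<xi>' y)))
      = (if \<xi> = \<xi>' then of_real (real p ^ 4) else 0)"
    by (intro sum_Fp4_chi_orthogonal[OF p]) (auto simp: sphere4_def)
qed simp

lemma sum_Fp4_by_sphere:
  assumes p: "p > 0"
  shows "(\<Sum>r\<in>Fp p. sum h (sphere4 p r)) = sum h (Fp4 p)"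
  unfolding sphere4_def by (rule sum.group) (auto simp: Q4_def mod_in_Fp p)

lemma sum_Fp_split:
  assumes "p > 0"
  shows "sum h (Fp p) = h 0 + sum h (Fp_units p)"
  unfolding Fp_units_def using assms by (subst sum.remove[of _ 0]) (auto simp: Fp_def)

lemma Q4_minus_commute: "Q4 p (x - y) = Q4 p (y - x)"
  by (simp add: Q4_def power2_commute)

lemma Q4_in_Fp: "p > 0 \<Longrightarrow> Q4 p x \<in> Fp p"
  by (simp add: Q4_def mod_in_Fp)

text \<open>
  Detect \<open>Q4 p (x - y) = t\<close> by orthogonality of characters.
\<close>

lemma dist_count_chi:
  assumes p: "p > 0" and t: "t \<in> Fp p" and E: "finite E"
  shows "of_nat p * of_nat (dist_count p E y t)
    = (\<Sum>s\<in>Fp p. (\<Sum>x\<in>E. chi p (s * Q4 p (x - y))) * chi p (- (s * t)))"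
proof -
  have "(\<Sum>s\<in>Fp p. (\<Sum>x\<in>E. chi p (s * Q4 p (x - y))) * chi p (- (s * t)))
      = (\<Sum>x\<in>E. \<Sum>s\<in>Fp p. chi p (s * (Q4 p (x - y) - t)))"
    by (subst sum.swap) (simp add: sum_distrib_right right_diff_distrib flip: chi_add)
  also have "\<dots> = (\<Sum>x\<in>E. if Q4 p (x - y) = t then of_nat p else 0)"
    using t by (intro sum.cong refl sum_Fp_chi_orthogonal p Q4_in_Fp)
  also have "\<dots> = of_nat p * of_nat (dist_count p E y t)"
    using E by (simp add: dist_count_def sum.If_cases Int_def mult.commute)
  finally show ?thesis by simp
qed

text \<open>
  \<open>w s\<close> represents \<open>- 1 / (4 s)\<close>. Injectivity allows a sum of squares over the dual parameters
  to be bounded by the sum over all residues, where Parseval applies.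
\<close>

lemma exists_dual_parameter:
  assumes "prime p" "odd p"
  shows "\<exists>w. (\<forall>s\<in>Fp_units p. w s \<in> Fp p \<and> [4 * w s * s = - 1] (mod int p)) \<and> inj_on w (Fp_units p)"
proof -
  have p: "p > 0" using assms prime_gt_0_nat by blast
  have "\<exists>u\<in>Fp p. [4 * u * s = - 1] (mod int p)" if "s \<in> Fp_units p" for s
  proof -
    have "coprime (int p) s"
      using \<open>prime p\<close> Fp_units_not_dvd[OF that] by (simp add: prime_imp_coprime)
    moreover have "coprime (int p) (2 ^ 2)"
      using \<open>odd p\<close> by (simp only: coprime_power_right_iff) simp
    ultimately have "coprime (4 * s) (int p)" by (simp add: coprime_commute)
    then obtain v where v: "[4 * s * v = 1] (mod int p)"
      using cong_solve_coprime_int by blast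
    have "[4 * ((- v) mod int p) * s = 4 * (- v) * s] (mod int p)"
      by (intro cong_mult) auto
    also have "4 * (- v) * s = - (4 * s * v)" by simp
    also have "[- (4 * s * v) = - 1] (mod int p)" using v by (simp add: cong_minus_minus_iff)
    finally show ?thesis using mod_in_Fp[OF p] by blast
  qed
  then obtain w where w: "w s \<in> Fp p" "[4 * w s * s = - 1] (mod int p)" if "s \<in> Fp_units p" for s
    by metis
  have "inj_on w (Fp_units p)"
  proof (rule inj_onI)
    fix s s' assume s: "s \<in> Fp_units p" "s' \<in> Fp_units p" "w s = w s'"
    \<comment> \<open>Multiply the relation for \<open>s\<close> by \<open>s'\<close> and conversely; the left-hand sides then agree.\<close>
    have "[s' * (4 * w s * s) = s' * - 1] (mod int p)" "[s * (4 * w s' * s') = s * - 1] (mod int p)"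
      by (intro cong_mult cong_refl w s)+
    moreover have "s' * (4 * w s * s) = s * (4 * w s' * s')" using s by simp
    ultimately have "[s' * - 1 = s * - 1] (mod int p)"
      by (metis cong_sym cong_trans)
    then have "[s = s'] (mod int p)" by (simp add: cong_minus_minus_iff cong_sym)
    then show "s = s'" using s by (auto intro: Fp_eqI simp: Fp_units_def)
  qed
  then show ?thesis using w by blast
qed

text \<open>
  The term \<open>s = 0\<close> of the character expansion contributes \<open>p\<^sup>3\<close>, and the other ones together
  at most \<open>p\<^sup>2\<close> because each four-dimensional Gauss sum equals \<open>p\<^sup>2\<close>.
\<close>

lemma card_sphere4_le:
  assumes "prime p" "odd p" "r \<in> Fp p"
  shows "real (card (sphere4 p r)) \<le> 2 * real p ^ 3"
proof -
  have p: "p > 0" using assms prime_gt_0_nat by blast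
  have count: "dist_count p (Fp4 p) 0 r = card (sphere4 p r)"
    by (simp add: dist_count_def sphere4_def)
  obtain w where w: "\<And>s. s \<in> Fp_units p \<Longrightarrow> [4 * w s * s = - 1] (mod int p)"
    using exists_dual_parameter assms by blast
  have Gauss: "(\<Sum>x\<in>Fp4 p. chi p (s * Q4 p x)) = of_nat p ^ 2" if "s \<in> Fp_units p" for s
  proof -
    have "[4 * s * w s = - 1] (mod int p)" using w[OF that] by (simp add: mult_ac)
    from Fourier_transform_chirp[OF assms(1,2) this, of 0] show ?thesis
      by (simp add: dot4_def Q4_def)
  qed
  have "real p * real (card (sphere4 p r))
      = cmod (\<Sum>s\<in>Fp p. (\<Sum>x\<in>Fp4 p. chi p (s * Q4 p (x - 0))) * chi p (- (s * r)))"
    unfolding dist_count_chi[OF p assms(3) finite_Fp4, symmetric] count by (simp add: norm_mult)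
  also have "\<dots> \<le> (\<Sum>s\<in>Fp p. cmod (\<Sum>x\<in>Fp4 p. chi p (s * Q4 p x)))"
    by (rule order_trans[OF norm_sum]) (simp add: norm_mult)
  also have "\<dots> = real p ^ 4 + (\<Sum>s\<in>Fp_units p. real p ^ 2)"
    by (simp add: sum_Fp_split[OF p] card_Fp4 Gauss norm_power)
  also have "\<dots> \<le> real p ^ 4 + (\<Sum>s\<in>Fp p. real p ^ 2)"
    by (intro add_left_mono sum_mono2) (auto simp: Fp_units_def)
  also have "\<dots> = real p ^ 4 + real p ^ 3" by (simp add: power_numeral_reduce)
  also have "\<dots> \<le> real p ^ 4 + real p ^ 4"
    using p by (intro add_left_mono power_increasing) auto
  also have "\<dots> = real p * (2 * real p ^ 3)" by (simp add: power_numeral_reduce)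
  finally show ?thesis using p by simp
qed

text \<open>
  The deviation of the number of points at distance \<open>t\<close> from its mean, expanded over the
  spheres in frequency space. For \<open>s \<noteq> 0\<close> the dual Gaussian decomposes the sum of
  \<open>chi p (s * Q4 p (x - y))\<close> over \<open>E\<close> into spherical components, the one with index \<open>r\<close> weighted by
  \<open>chi p (w s * r)\<close>. On the cone \<open>r = 0\<close> this weight is \<open>1\<close>, so for \<open>t \<noteq> 0\<close> the remaining
  sum over \<open>s\<close> is \<open>- 1\<close>: the cone enters with a coefficient of modulus \<open>1\<close>.
\<close>

lemma dist_count_expansion:
  assumes "prime p" "odd p" and E: "E \<subseteq> Fp4 p" and t: "t \<in> Fp_units p"
    and w: "\<And>s. s \<in> Fp_units p \<Longrightarrow> [4 * w s * s = - 1] (mod int p)"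
  shows "of_nat p ^ 3 * (of_nat (dist_count p E y t) - of_nat (card E) / of_nat p)
    = - sphere_component p E 0 y
      + (\<Sum>s\<in>Fp_units p. (\<Sum>r\<in>Fp_units p. sphere_component p E r y * chi p (w s * r)) * chi p (- (s * t)))"
proof -
  have p: "p > 0" using assms prime_gt_0_nat by blast
  have finE: "finite E" by (rule finite_subset[OF E finite_Fp4])
  have tF: "t \<in> Fp p" "\<not> int p dvd - t"
    using t Fp_units_not_dvd[OF t] by (auto simp: Fp_units_def)
  define A where "A r = sphere_component p E r y" for r
  define D where "D s = (\<Sum>x\<in>E. chi p (s * Q4 p (x - y)))" for s
  define B where "B s = (\<Sum>r\<in>Fp_units p. A r * chi p (w s * r))" for s
  have D: "of_nat p ^ 2 * D s = A 0 + B s" if "s \<in> Fp_units p" for s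
  proof -
    have "of_nat p ^ 2 * D s = (\<Sum>x\<in>E. of_nat p ^ 2 * chi p (s * Q4 p (y - x)))"
      by (simp add: D_def sum_distrib_left Q4_minus_commute[of p y])
    also have "\<dots> = (\<Sum>x\<in>E. \<Sum>\<xi>\<in>Fp4 p. chi p (w s * Q4 p \<xi>) * chi p (dot4 p \<xi> (y - x)))"
      by (simp add: Fourier_transform_chirp[OF assms(1,2) w[OF that]])
    also have "\<dots> = (\<Sum>\<xi>\<in>Fp4 p. chi p (w s * Q4 p \<xi>) * (fourier4 p E \<xi> * chi p (dot4 p \<xi> y)))"
      unfolding fourier4_def sum_distrib_left sum_distrib_right
      by (subst sum.swap, intro sum.cong refl)
         (simp add: chi_dot4_add_right[OF p] chi_dot4_minus_right[OF p] mult_ac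
           flip: add_uminus_conv_diff)
    also have "\<dots> = (\<Sum>r\<in>Fp p. A r * chi p (w s * r))"
      unfolding sum_Fp4_by_sphere[OF p, symmetric] A_def sphere_component_def sum_distrib_right
      by (intro sum.cong refl) (simp add: sphere4_def mult_ac)
    also have "\<dots> = A 0 + B s" by (simp add: sum_Fp_split[OF p] B_def)
    finally show ?thesis .
  qed
  have "(\<Sum>s\<in>Fp p. chi p (s * - t)) = 0" using tF by (simp only: sum_Fp_chi[OF p]) simp
  then have units: "(\<Sum>s\<in>Fp_units p. chi p (- (s * t))) = - 1"
    by (simp add: sum_Fp_split[OF p] add_eq_0_iff)
  have "of_nat p ^ 2 * (of_nat p * of_nat (dist_count p E y t))
      = of_nat p ^ 2 * (D 0 + (\<Sum>s\<in>Fp_units p. D s * chi p (- (s * t))))"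
    unfolding dist_count_chi[OF p tF(1) finE] sum_Fp_split[OF p] by (simp add: D_def)
  also have "\<dots> = of_nat p ^ 2 * of_nat (card E) + (\<Sum>s\<in>Fp_units p. (A 0 + B s) * chi p (- (s * t)))"
    by (simp add: ring_distribs sum_distrib_left D_def[of 0] flip: D mult.assoc)
  also have "(\<Sum>s\<in>Fp_units p. (A 0 + B s) * chi p (- (s * t)))
      = A 0 * (\<Sum>s\<in>Fp_units p. chi p (- (s * t))) + (\<Sum>s\<in>Fp_units p. B s * chi p (- (s * t)))"
    by (simp add: ring_distribs sum.distrib sum_distrib_left)
  finally have "of_nat p ^ 2 * (of_nat p * of_nat (dist_count p E y t))
      = of_nat p ^ 2 * of_nat (card E) + (- A 0 + (\<Sum>s\<in>Fp_units p. B s * chi p (- (s * t))))"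
    by (simp add: units)
  moreover have "of_nat p ^ 3 * (of_nat (dist_count p E y t) - of_nat (card E) / of_nat p)
      = of_nat p ^ 2 * (of_nat p * of_nat (dist_count p E y t)) - of_nat p ^ 2 * (of_nat (card E) :: complex)"
    using p by (simp add: field_simps power_numeral_reduce)
  ultimately show ?thesis unfolding A_def B_def by simp
qed

lemma cmod_add_square_le: "(cmod (a + b))\<^sup>2 \<le> 2 * (cmod a)\<^sup>2 + 2 * (cmod b)\<^sup>2"
proof -
  have "(cmod (a + b))\<^sup>2 \<le> (cmod a + cmod b)\<^sup>2"
    by (intro power_mono norm_triangle_ineq) simp
  also have "\<dots> \<le> 2 * (cmod a)\<^sup>2 + 2 * (cmod b)\<^sup>2"
    using sum_squares_bound[of "cmod a" "cmod b"] by (simp add: power2_sum)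
  finally show ?thesis .
qed

text \<open>
  Parseval is used twice: in \<open>t\<close> against the frequencies \<open>s\<close>, and then in the dual
  parameter \<open>w s\<close> against the radii \<open>r\<close>. Each application costs a factor \<open>p\<close>, so the
  spheres appear with \<open>p\<^sup>2\<close>; the cone has coefficient \<open>- 1\<close> for every \<open>t\<close> and costs only
  the number of values of \<open>t\<close>, at most \<open>p\<close>.
\<close>

lemma dist_count_variance_le:
  assumes "prime p" "odd p" and E: "E \<subseteq> Fp4 p"
  shows "real p ^ 6 * (\<Sum>t\<in>Fp_units p. (real (dist_count p E y t) - real (card E) / real p)\<^sup>2)
    \<le> 2 * real p * (cmod (sphere_component p E 0 y))\<^sup>2
      + 2 * real p ^ 2 * (\<Sum>r\<in>Fp_units p. (cmod (sphere_component p E r y))\<^sup>2)"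
proof -
  have p: "p > 0" using assms prime_gt_0_nat by blast
  obtain w where w: "\<And>s. s \<in> Fp_units p \<Longrightarrow> w s \<in> Fp p"
      "\<And>s. s \<in> Fp_units p \<Longrightarrow> [4 * w s * s = - 1] (mod int p)" and inj: "inj_on w (Fp_units p)"
    using exists_dual_parameter assms by metis
  define A where "A r = sphere_component p E r y" for r
  define B where "B u = (\<Sum>r\<in>Fp_units p. A r * chi p (u * r))" for u
  define C where "C t = (\<Sum>s\<in>Fp_units p. B (w s) * chi p (- (s * t)))" for t
  have units: "Fp_units p \<subseteq> Fp p" by (auto simp: Fp_units_def)
  have orth: "(\<Sum>y\<in>Fp p. chi p (y * x) * cnj (chi p (y * x'))) = (if x = x' then of_real (real p) else 0)"
    if "x \<in> Fp_units p" "x' \<in> Fp_units p" for x x'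
  proof -
    have "(\<Sum>y\<in>Fp p. chi p (y * x) * cnj (chi p (y * x'))) = (\<Sum>y\<in>Fp p. chi p (y * (x - x')))"
      by (simp add: cnj_chi right_diff_distrib flip: chi_add)
    also have "\<dots> = (if x = x' then of_nat p else 0)"
      using that units by (intro sum_Fp_chi_orthogonal p) auto
    finally show ?thesis by simp
  qed
  have orth': "(\<Sum>t\<in>Fp p. chi p (- (s * t)) * cnj (chi p (- (s' * t)))) = (if s = s' then of_real (real p) else 0)"
    if "s \<in> Fp_units p" "s' \<in> Fp_units p" for s s'
    using orth[OF that(2,1)] by (simp add: cnj_chi mult.commute eq_commute)
  have point: "real p ^ 6 * (real (dist_count p E y t) - real (card E) / real p)\<^sup>2
      \<le> 2 * (cmod (A 0))\<^sup>2 + 2 * (cmod (C t))\<^sup>2" if t: "t \<in> Fp_units p" for t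
  proof -
    have "complex_of_real (real p ^ 3 * (real (dist_count p E y t) - real (card E) / real p)) = - A 0 + C t"
      using dist_count_expansion[OF assms t w(2), of y] unfolding A_def B_def C_def by simp
    then have "(real p ^ 3 * (real (dist_count p E y t) - real (card E) / real p))\<^sup>2 = (cmod (- A 0 + C t))\<^sup>2"
      by (metis norm_of_real power2_abs)
    then show ?thesis
      using cmod_add_square_le[of "- A 0" "C t"] by (simp add: power_mult_distrib flip: power_mult)
  qed
  have "real p ^ 6 * (\<Sum>t\<in>Fp_units p. (real (dist_count p E y t) - real (card E) / real p)\<^sup>2)
      \<le> (\<Sum>t\<in>Fp_units p. 2 * (cmod (A 0))\<^sup>2 + 2 * (cmod (C t))\<^sup>2)"
    unfolding sum_distrib_left by (intro sum_mono point)
  also have "\<dots> \<le> (\<Sum>t\<in>Fp p. 2 * (cmod (A 0))\<^sup>2 + 2 * (cmod (C t))\<^sup>2)"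
    by (rule sum_mono2) (auto simp: Fp_units_def)
  also have "\<dots> = 2 * real p * (cmod (A 0))\<^sup>2 + 2 * (\<Sum>t\<in>Fp p. (cmod (C t))\<^sup>2)"
    by (simp add: sum.distrib sum_distrib_left)
  also have "(\<Sum>t\<in>Fp p. (cmod (C t))\<^sup>2) = real p * (\<Sum>s\<in>Fp_units p. (cmod (B (w s)))\<^sup>2)"
    unfolding C_def by (rule sum_cmod_square_orthogonal[OF orth']) auto
  also have "(\<Sum>s\<in>Fp_units p. (cmod (B (w s)))\<^sup>2) = (\<Sum>u\<in>w ` Fp_units p. (cmod (B u))\<^sup>2)"
    by (simp add: sum.reindex[OF inj])
  also have "\<dots> \<le> (\<Sum>u\<in>Fp p. (cmod (B u))\<^sup>2)"
    using w(1) by (intro sum_mono2) auto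
  also have "\<dots> = real p * (\<Sum>r\<in>Fp_units p. (cmod (A r))\<^sup>2)"
    unfolding B_def by (rule sum_cmod_square_orthogonal[OF orth]) auto
  finally show ?thesis
    using p by (simp add: A_def power2_eq_square mult_left_mono mult.assoc)
qed

section \<open>The restriction exponent\<close>

text \<open>
  The set whose infimum is \<open>Lambda_S\<close>.
\<close>

definition admissible_exponents :: "nat \<Rightarrow> int \<Rightarrow> real \<Rightarrow> real set" where
  "admissible_exponents p j \<theta> = {l. 0 \<le> l \<and>
     (\<forall>E f. E \<subseteq> Fp4 p \<longrightarrow> 1 \<le> card E \<longrightarrow> real (card E) \<le> real p powr \<theta> \<longrightarrow>
        L2_set (\<lambda>x. cmod (sphere_ext p j f x)) E \<le> real p powr l * sphere_L2_norm p j f)}"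

lemma sphere_L2_norm_square:
  "(sphere_L2_norm p j f)\<^sup>2 = (1 / real (card (sphere4 p j))) * (\<Sum>\<xi>\<in>sphere4 p j. (cmod (f \<xi>))\<^sup>2)"
  unfolding sphere_L2_norm_def by (simp add: sum_nonneg)

lemma sphere_L2_norm_nonneg: "0 \<le> sphere_L2_norm p j f"
  unfolding sphere_L2_norm_def by (simp add: sum_nonneg)

text \<open>
  The Cauchy--Schwarz inequality on the sphere.
\<close>

lemma cmod_sphere_ext_le: "cmod (sphere_ext p j f x) \<le> sphere_L2_norm p j f"
proof (rule power2_le_imp_le[OF _ sphere_L2_norm_nonneg])
  let ?S = "sphere4 p j"
  have "cmod (sphere_ext p j f x) \<le> (1 / real (card ?S)) * (\<Sum>y\<in>?S. cmod (f y))"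
    unfolding sphere_ext_def norm_mult
    by (rule mult_mono) (auto simp: norm_divide norm_mult intro!: order_trans[OF norm_sum])
  then have "(cmod (sphere_ext p j f x))\<^sup>2 \<le> ((1 / real (card ?S)) * (\<Sum>y\<in>?S. cmod (f y)))\<^sup>2"
    by (rule power_mono) simp
  also have "\<dots> = (1 / real (card ?S))\<^sup>2 * (\<Sum>y\<in>?S. cmod (f y))\<^sup>2"
    by (rule power_mult_distrib)
  also have "\<dots> \<le> (1 / real (card ?S))\<^sup>2 * ((\<Sum>y\<in>?S. (cmod (f y))\<^sup>2) * real (card ?S))"
    by (intro mult_left_mono sum_squared_le_sum_of_squares) auto
  also have "\<dots> = (sphere_L2_norm p j f)\<^sup>2"
    by (simp add: sphere_L2_norm_square power2_eq_square[of "1 / _"])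
  finally show "(cmod (sphere_ext p j f x))\<^sup>2 \<le> (sphere_L2_norm p j f)\<^sup>2" .
qed

text \<open>
  The trivial exponent, from the pointwise bound and \<open>card E \<le> p ^ 4\<close>. It shows that
  \<open>Lambda_S\<close> is the infimum of a nonempty set, without which \<open>Inf\<close> would carry no information.
\<close>

lemma two_admissible:
  assumes p: "p > 0"
  shows "2 \<in> admissible_exponents p j \<theta>"
  unfolding admissible_exponents_def
proof (clarify, intro conjI allI impI)
  fix E f assume E: "E \<subseteq> Fp4 p"
  have "L2_set (\<lambda>x. cmod (sphere_ext p j f x)) E \<le> L2_set (\<lambda>x. sphere_L2_norm p j f) E"
    by (rule L2_set_mono) (auto simp: cmod_sphere_ext_le)
  also have "\<dots> = sqrt (real (card E)) * sphere_L2_norm p j f"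
    by (simp add: L2_set_def real_sqrt_mult sphere_L2_norm_nonneg)
  also have "\<dots> \<le> sqrt (real p ^ 4) * sphere_L2_norm p j f"
    using card_mono[OF finite_Fp4 E] card_Fp4[of p]
    by (intro mult_right_mono real_sqrt_le_mono sphere_L2_norm_nonneg) (metis of_nat_le_iff of_nat_power)
  also have "sqrt (real p ^ 4) = real p powr 2"
    using p by (simp add: real_sqrt_unique)
  finally show "L2_set (\<lambda>x. cmod (sphere_ext p j f x)) E \<le> real p powr 2 * sphere_L2_norm p j f" .
qed simp

lemma Lambda_S_nonneg:
  assumes "p > 0"
  shows "0 \<le> Lambda_S p j \<theta>"
proof -
  have "0 \<le> Inf (admissible_exponents p j \<theta>)"
  proof (rule cInf_greatest)
    show "admissible_exponents p j \<theta> \<noteq> {}" using two_admissible[OF assms] by blast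
  qed (simp add: admissible_exponents_def)
  then show ?thesis by (simp add: Lambda_S_def admissible_exponents_def)
qed

text \<open>
  The infimum is attained: the estimate holds for every exponent above it, and the bound
  depends continuously on the exponent.
\<close>

lemma L2_set_sphere_ext_le:
  assumes p: "p > 1" and E: "E \<subseteq> Fp4 p" "1 \<le> card E" "real (card E) \<le> real p powr \<theta>"
    and L: "Lambda_S p j \<theta> \<le> L"
  shows "L2_set (\<lambda>x. cmod (sphere_ext p j f x)) E \<le> real p powr L * sphere_L2_norm p j f"
proof (rule tendsto_lowerbound)
  show "((\<lambda>l. real p powr l * sphere_L2_norm p j f) \<longlongrightarrow> real p powr L * sphere_L2_norm p j f) (at_right L)"
    using p by (intro tendsto_intros) auto
  have "L2_set (\<lambda>x. cmod (sphere_ext p j f x)) E \<le> real p powr l * sphere_L2_norm p j f" if "L < l" for l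
  proof -
    have "Inf (admissible_exponents p j \<theta>) < l"
      using L that by (simp add: Lambda_S_def admissible_exponents_def)
    then obtain m where m: "m \<in> admissible_exponents p j \<theta>" "m < l"
      using two_admissible[of p] p by (metis cInf_lessD empty_iff less_trans zero_less_one)
    then have "L2_set (\<lambda>x. cmod (sphere_ext p j f x)) E \<le> real p powr m * sphere_L2_norm p j f"
      using E by (simp add: admissible_exponents_def)
    also have "\<dots> \<le> real p powr l * sphere_L2_norm p j f"
      using m p by (intro mult_right_mono sphere_L2_norm_nonneg powr_mono) auto
    finally show ?thesis .
  qed
  then show "\<forall>\<^sub>F l in at_right L. L2_set (\<lambda>x. cmod (sphere_ext p j f x)) E \<le> real p powr l * sphere_L2_norm p j f"
    by (auto simp: eventually_at_filter)
qed auto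

section \<open>The mean square over pins and distances\<close>

text \<open>
  On an empty sphere both sides vanish, because the factor \<open>1 / 0\<close> in \<open>sphere_ext\<close> is \<open>0\<close>.
\<close>

lemma sphere_component_eq_ext:
  "sphere_component p E r y = of_nat (card (sphere4 p r)) * sphere_ext p r (fourier4 p E) y"
  by (auto simp: sphere_component_def sphere_ext_def)

text \<open>
  The extension estimate is applied to the Fourier transform of \<open>E\<close> on the sphere. Passing from
  the normalised sums on both of its sides to the unnormalised ones here leaves one factor
  \<open>card (sphere4 p r)\<close>.
\<close>

lemma sum_cmod_sphere_component_restriction:
  assumes "prime p" "odd p" and r: "r \<in> Fp p"
    and F: "F \<subseteq> Fp4 p" "1 \<le> card F" "real (card F) \<le> real p powr \<theta>"
    and L: "Lambda_S p r \<theta> \<le> L"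
  shows "(\<Sum>y\<in>F. (cmod (sphere_component p E r y))\<^sup>2)
    \<le> 2 * real p ^ 3 * real p powr (2 * L) * (\<Sum>\<xi>\<in>sphere4 p r. (cmod (fourier4 p E \<xi>))\<^sup>2)"
proof -
  have p: "p > 1" using assms prime_gt_1_nat by blast
  define n where "n = real (card (sphere4 p r))"
  define M where "M = (\<Sum>\<xi>\<in>sphere4 p r. (cmod (fourier4 p E \<xi>))\<^sup>2)"
  have M: "M \<ge> 0" by (simp add: M_def sum_nonneg)
  have "(\<Sum>y\<in>F. (cmod (sphere_component p E r y))\<^sup>2)
      = n\<^sup>2 * (L2_set (\<lambda>y. cmod (sphere_ext p r (fourier4 p E) y)) F)\<^sup>2"
    by (simp add: sphere_component_eq_ext norm_mult power_mult_distrib L2_set_def sum_nonneg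
        sum_distrib_left n_def)
  also have "\<dots> \<le> n\<^sup>2 * (real p powr L * sphere_L2_norm p r (fourier4 p E))\<^sup>2"
    by (intro mult_left_mono power_mono L2_set_sphere_ext_le[OF p F L]) auto
  also have "\<dots> = n * real p powr (2 * L) * M"
  proof -
    have "(real p powr L)\<^sup>2 = real p powr (2 * L)"
      by (simp add: power2_eq_square flip: powr_add)
    then show ?thesis
      by (simp add: power_mult_distrib sphere_L2_norm_square power2_eq_square[of n] flip: n_def M_def)
  qed
  also have "\<dots> \<le> 2 * real p ^ 3 * real p powr (2 * L) * M"
    unfolding n_def using card_sphere4_le[OF assms(1-3)] M by (intro mult_right_mono) auto
  finally show ?thesis by (simp add: M_def)
qed

text \<open>
  The spheres \<open>r \<noteq> 0\<close> are controlled by the restriction estimate. Nothing is assumed about the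
  cone, but Parseval over all pins \<open>y\<close>, together with the factor \<open>p\<close> gained on the cone, bounds
  it by the same quantity because \<open>L \<ge> 0\<close>. The energies on the different spheres
  then add up to the full energy of the Fourier transform.
\<close>

lemma sum_dist_count_variance_le:
  assumes "prime p" "odd p" and E: "E \<subseteq> Fp4 p"
    and F: "F \<subseteq> Fp4 p" "1 \<le> card F" "real (card F) \<le> real p powr \<theta>"
    and L: "\<And>j. j \<in> Fp_units p \<Longrightarrow> Lambda_S p j \<theta> \<le> L"
  shows "(\<Sum>y\<in>F. \<Sum>t\<in>Fp_units p. (real (dist_count p E y t) - real (card E) / real p)\<^sup>2)
    \<le> 4 * real p powr (3 + 2 * L) * real (card E)"
proof -
  have p: "p > 0" using assms prime_gt_0_nat by blast
  have "1 \<in> Fp_units p" using prime_gt_1_nat[OF assms(1)] by (auto simp: Fp_units_def Fp_def)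
  then have "L \<ge> 0" using L Lambda_S_nonneg[OF p] by (meson order_trans)
  then have P: "1 \<le> real p powr (2 * L)" using p by (simp add: ge_one_powr_ge_zero)
  define M where "M r = (\<Sum>\<xi>\<in>sphere4 p r. (cmod (fourier4 p E \<xi>))\<^sup>2)" for r
  have M: "M r \<ge> 0" for r by (simp add: M_def sum_nonneg)
  have zero: "(\<Sum>y\<in>F. (cmod (sphere_component p E 0 y))\<^sup>2) \<le> real p ^ 4 * M 0"
    unfolding M_def sum_cmod_sphere_component_square[OF p, symmetric]
    using F by (intro sum_mono2) auto
  have unit: "(\<Sum>y\<in>F. (cmod (sphere_component p E r y))\<^sup>2) \<le> 2 * real p ^ 3 * real p powr (2 * L) * M r"
    if "r \<in> Fp_units p" for r
    unfolding M_def using that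
    by (intro sum_cmod_sphere_component_restriction[OF assms(1,2) _ F L]) (auto simp: Fp_units_def)
  have "real p ^ 6 * (\<Sum>y\<in>F. \<Sum>t\<in>Fp_units p. (real (dist_count p E y t) - real (card E) / real p)\<^sup>2)
      \<le> (\<Sum>y\<in>F. 2 * real p * (cmod (sphere_component p E 0 y))\<^sup>2
        + 2 * real p ^ 2 * (\<Sum>r\<in>Fp_units p. (cmod (sphere_component p E r y))\<^sup>2))"
    unfolding sum_distrib_left[of _ _ F] by (intro sum_mono dist_count_variance_le assms)
  also have "\<dots> = 2 * real p * (\<Sum>y\<in>F. (cmod (sphere_component p E 0 y))\<^sup>2)
      + 2 * real p ^ 2 * (\<Sum>r\<in>Fp_units p. \<Sum>y\<in>F. (cmod (sphere_component p E r y))\<^sup>2)"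
    unfolding sum.distrib sum_distrib_left[symmetric] sum.swap[of _ "Fp_units p" F] by (rule refl)
  also have "\<dots> \<le> 2 * real p * (real p ^ 4 * M 0)
      + 2 * real p ^ 2 * (\<Sum>r\<in>Fp_units p. 2 * real p ^ 3 * real p powr (2 * L) * M r)"
    by (intro add_mono mult_left_mono sum_mono zero unit) auto
  also have "\<dots> = 2 * real p ^ 5 * (1 * M 0)
      + 4 * real p ^ 5 * real p powr (2 * L) * (\<Sum>r\<in>Fp_units p. M r)"
    unfolding sum_distrib_left[symmetric] by (simp add: power_numeral_reduce)
  also have "\<dots> \<le> 4 * real p ^ 5 * (real p powr (2 * L) * M 0)
      + 4 * real p ^ 5 * real p powr (2 * L) * (\<Sum>r\<in>Fp_units p. M r)"
    using P M by (intro add_mono mult_mono order_refl) auto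
  also have "\<dots> = 4 * real p ^ 5 * real p powr (2 * L) * (\<Sum>r\<in>Fp p. M r)"
    by (simp add: sum_Fp_split[OF p] algebra_simps)
  also have "(\<Sum>r\<in>Fp p. M r) = real p ^ 4 * real (card E)"
    unfolding M_def by (simp add: sum_Fp4_by_sphere[OF p] sum_cmod_fourier4_square[OF p E])
  also have "4 * real p ^ 5 * real p powr (2 * L) * (real p ^ 4 * real (card E))
      = real p ^ 6 * (4 * real p powr (3 + 2 * L) * real (card E))"
    using p by (simp add: powr_add power_numeral_reduce)
  finally show ?thesis using p by simp
qed

section \<open>Pins with few missing distances\<close>

text \<open>
  A distance that does not occur deviates from the mean \<open>card E / p\<close> by exactly this mean.
\<close>

lemma missing_distances_le_variance:
  "real (card (Fp_units p - pinned_dist p y E)) * (real (card E) / real p)\<^sup>2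
    \<le> (\<Sum>t\<in>Fp_units p. (real (dist_count p E y t) - real (card E) / real p)\<^sup>2)"
proof -
  have "real (card (Fp_units p - pinned_dist p y E)) * (real (card E) / real p)\<^sup>2
      = (\<Sum>t\<in>Fp_units p - pinned_dist p y E. (real (dist_count p E y t) - real (card E) / real p)\<^sup>2)"
  proof -
    have "dist_count p E y t = 0" if "t \<notin> pinned_dist p y E" for t
      using that by (auto simp: dist_count_def pinned_dist_def card_eq_0_iff)
    then show ?thesis by simp
  qed
  also have "\<dots> \<le> (\<Sum>t\<in>Fp_units p. (real (dist_count p E y t) - real (card E) / real p)\<^sup>2)"
    by (intro sum_mono2) auto
  finally show ?thesis .
qed

text \<open>
  The additional \<open>1\<close> accounts for the distance \<open>0\<close>, which is excluded from the variance.
\<close>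

lemma card_pinned_dist_deviation:
  assumes p: "p > 0"
  shows "\<bar>real (card (pinned_dist p y E)) - real p\<bar> \<le> real (card (Fp_units p - pinned_dist p y E)) + 1"
proof -
  let ?D = "pinned_dist p y E"
  have D: "?D \<subseteq> Fp p" by (auto simp: pinned_dist_def Q4_in_Fp p)
  then have "finite ?D" by (rule finite_subset) simp
  have "card (Fp p) \<le> card (insert 0 (?D \<union> (Fp_units p - ?D)))"
    using \<open>finite ?D\<close> by (intro card_mono) (auto simp: Fp_units_def)
  also have "\<dots> \<le> card (?D \<union> (Fp_units p - ?D)) + 1"
    using \<open>finite ?D\<close> by (simp add: card_insert_if)
  also have "\<dots> \<le> card ?D + card (Fp_units p - ?D) + 1"
    by (intro add_right_mono card_Un_le)
  finally have "p \<le> card ?D + card (Fp_units p - ?D) + 1" by simp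
  moreover have "card ?D \<le> p" using card_mono[OF finite_Fp D] by simp
  ultimately show ?thesis by linarith
qed

text \<open>
  Markov's inequality. The surplus \<open>p powr \<epsilon>\<close> in the size hypothesis is split evenly
  between the proportion of missing distances and the proportion of bad pins.
\<close>

lemma card_bad_pins_le:
  assumes "prime p" "odd p" and E: "E \<subseteq> Fp4 p"
    and F: "F \<subseteq> Fp4 p" "1 \<le> card F" "real (card F) \<le> real p powr \<theta>"
    and L: "\<And>j. j \<in> Fp_units p \<Longrightarrow> Lambda_S p j \<theta> \<le> L"
    and EF: "real p powr (4 + 2 * L + \<epsilon>) \<le> real (card E) * real (card F)"
  shows "real (card {y \<in> F. real p powr (- \<epsilon> / 2) * real p < real (card (Fp_units p - pinned_dist p y E))})
    \<le> 4 * real p powr (- \<epsilon> / 2) * real (card F)"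
proof -
  have p: "p > 0" using assms prime_gt_0_nat by blast
  define d where "d = real p powr (- \<epsilon> / 2)"
  define e where "e = real (card E)"
  define B where "B = {y \<in> F. d * real p < real (card (Fp_units p - pinned_dist p y E))}"
  define P where "P = real p powr (3 + 2 * L)"
  have d: "d > 0" using p by (simp add: d_def)
  have "0 < real (card E) * real (card F)"
    using EF p by (smt (verit) powr_gt_zero of_nat_0_less_iff)
  then have e: "e > 0" by (simp add: e_def zero_less_mult_iff)
  have finF: "finite F" by (rule finite_subset[OF F(1) finite_Fp4])
  have "real (card B) * (d * real p * (e / real p)\<^sup>2) = (\<Sum>y\<in>B. d * real p * (e / real p)\<^sup>2)" by simp
  also have "\<dots> \<le> (\<Sum>y\<in>B. \<Sum>t\<in>Fp_units p. (real (dist_count p E y t) - real (card E) / real p)\<^sup>2)"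
  proof (rule sum_mono)
    fix y assume "y \<in> B"
    then have "d * real p * (e / real p)\<^sup>2
        \<le> real (card (Fp_units p - pinned_dist p y E)) * (e / real p)\<^sup>2"
      by (intro mult_right_mono) (auto simp: B_def)
    also have "\<dots> \<le> (\<Sum>t\<in>Fp_units p. (real (dist_count p E y t) - real (card E) / real p)\<^sup>2)"
      unfolding e_def by (rule missing_distances_le_variance)
    finally show "d * real p * (e / real p)\<^sup>2 \<le> \<dots>" .
  qed
  also have "\<dots> \<le> (\<Sum>y\<in>F. \<Sum>t\<in>Fp_units p. (real (dist_count p E y t) - real (card E) / real p)\<^sup>2)"
    using finF by (intro sum_mono2) (auto simp: B_def sum_nonneg)
  also have "\<dots> \<le> 4 * P * e"
    unfolding P_def e_def by (rule sum_dist_count_variance_le[OF assms(1,2) E F L])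
  finally have "real (card B) * d * e \<le> 4 * (P * real p)"
    using p e by (simp add: field_simps power2_eq_square)
  also have "P * real p = d * d * real p powr (4 + 2 * L + \<epsilon>)"
  proof -
    have "P * real p = real p powr (3 + 2 * L) * real p powr 1" using p by (simp add: P_def)
    also have "\<dots> = real p powr (4 + 2 * L)" unfolding powr_add[symmetric] by simp
    finally show ?thesis unfolding d_def by (simp flip: powr_add)
  qed
  also have "4 * \<dots> \<le> 4 * (d * d * (e * real (card F)))"
    using EF d by (simp add: e_def)
  finally have "real (card B) * (d * e) \<le> 4 * d * real (card F) * (d * e)"
    by (simp add: mult_ac)
  then have "real (card B) \<le> 4 * d * real (card F)"
    by (rule mult_right_le_imp_le) (use d e in simp)
  then show ?thesis by (simp only: B_def d_def)
qed

section \<open>Pinned distance sets of nearly full size\<close>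

theorem theorem1p7:
  fixes p\<^sub>3 :: nat and \<epsilon> :: real
  assumes "p\<^sub>3 > 2" and "\<epsilon> > 0"
  shows "\<exists>\<eta> \<eta>' :: nat \<Rightarrow> real. \<eta> \<longlonglongrightarrow> 0 \<and> \<eta>' \<longlonglongrightarrow> 0 \<and>
    (\<forall>\<Lambda> :: real \<Rightarrow> real.
      (\<forall>p \<theta>. prime p \<and> p \<ge> p\<^sub>3 \<and> 0 \<le> \<theta> \<and> \<theta> \<le> 4 \<longrightarrow>
         (SUP j\<in>Fp_units p. Lambda_S p j \<theta>) \<le> \<Lambda> \<theta>) \<longrightarrow>
      (\<forall>p E F. prime p \<and> odd p \<and> E \<subseteq> Fp4 p \<and> F \<subseteq> Fp4 p \<and>
         (\<exists>\<theta>. 0 \<le> \<theta> \<and> \<theta> \<le> 4 \<and> 1 \<le> card F \<and> real (card F) \<le> real p powr \<theta> \<and>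
            real (card E) * real (card F) \<ge> real p powr (4 + 2 * \<Lambda> \<theta> + \<epsilon>)) \<longrightarrow>
         (\<exists>F'. F' \<subseteq> F \<and>
            \<bar>real (card F') - real (card F)\<bar> \<le> \<eta> p * real (card F) \<and>
            (\<forall>y\<in>F'. \<bar>real (card (pinned_dist p y E)) - real p\<bar> \<le> \<eta>' p * real p))))"
proof -
  \<comment> \<open>Below \<open>p\<^sub>3\<close> the estimates are unavailable; the value \<open>1\<close> then permits \<open>F' = {}\<close>.\<close>
  define \<eta> where "\<eta> p = (if p < p\<^sub>3 then 1 else 4 * real p powr (- \<epsilon> / 2))" for p
  define \<eta>' where "\<eta>' p = real p powr (- \<epsilon> / 2) + 1 / real p" for p :: nat
  have decay: "(\<lambda>p. real p powr (- \<epsilon> / 2)) \<longlonglongrightarrow> 0"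
    using \<open>\<epsilon> > 0\<close> by (intro tendsto_neg_powr filterlim_real_sequentially) auto
  have "(\<lambda>p. 4 * real p powr (- \<epsilon> / 2)) \<longlonglongrightarrow> 0"
    using tendsto_mult_right_zero[OF decay] by simp
  moreover have "\<forall>\<^sub>F p in sequentially. 4 * real p powr (- \<epsilon> / 2) = \<eta> p"
    using eventually_ge_at_top[of p\<^sub>3] by eventually_elim (simp add: \<eta>_def)
  ultimately have \<eta>: "\<eta> \<longlonglongrightarrow> 0" by (rule Lim_transform_eventually)
  have \<eta>': "\<eta>' \<longlonglongrightarrow> 0"
    using tendsto_add[OF decay lim_1_over_n] unfolding \<eta>'_def by simp
  have main: "\<exists>F'\<subseteq>F. \<bar>real (card F') - real (card F)\<bar> \<le> \<eta> p * real (card F) \<and>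
      (\<forall>y\<in>F'. \<bar>real (card (pinned_dist p y E)) - real p\<bar> \<le> \<eta>' p * real p)"
    if \<Lambda>: "\<forall>p \<theta>. prime p \<and> p \<ge> p\<^sub>3 \<and> 0 \<le> \<theta> \<and> \<theta> \<le> 4 \<longrightarrow> (SUP j\<in>Fp_units p. Lambda_S p j \<theta>) \<le> \<Lambda> \<theta>"
      and p: "prime p" "odd p" and E: "E \<subseteq> Fp4 p" and F: "F \<subseteq> Fp4 p" "1 \<le> card F" "real (card F) \<le> real p powr \<theta>"
      and \<theta>: "0 \<le> \<theta>" "\<theta> \<le> 4" and EF: "real p powr (4 + 2 * \<Lambda> \<theta> + \<epsilon>) \<le> real (card E) * real (card F)"
    for \<Lambda> :: "real \<Rightarrow> real" and p E F \<theta>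
  proof (cases "p < p\<^sub>3")
    case True
    then show ?thesis by (intro exI[of _ "{}"]) (simp add: \<eta>_def)
  next
    case False
    have p0: "p > 0" using p prime_gt_0_nat by blast
    \<comment> \<open>The supremum is over a finite set, hence it is an upper bound.\<close>
    have L: "Lambda_S p j \<theta> \<le> \<Lambda> \<theta>" if "j \<in> Fp_units p" for j
    proof -
      have "Lambda_S p j \<theta> \<le> (SUP j\<in>Fp_units p. Lambda_S p j \<theta>)"
        using that by (intro cSUP_upper) auto
      also have "\<dots> \<le> \<Lambda> \<theta>" using \<Lambda> False p \<theta> by simp
      finally show ?thesis .
    qed
    define B where "B = {y \<in> F. real p powr (- \<epsilon> / 2) * real p < real (card (Fp_units p - pinned_dist p y E))}"
    have B: "real (card B) \<le> \<eta> p * real (card F)"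
      using card_bad_pins_le[OF p E F L EF] False by (simp add: B_def \<eta>_def)
    have "finite F" by (rule finite_subset[OF F(1) finite_Fp4])
    then have "card F = card (F - B) + card B"
      by (subst card_Un_disjoint[symmetric]) (auto simp: B_def intro: arg_cong[of _ _ card])
    then have "\<bar>real (card (F - B)) - real (card F)\<bar> \<le> \<eta> p * real (card F)"
      using B by simp
    moreover have "\<bar>real (card (pinned_dist p y E)) - real p\<bar> \<le> \<eta>' p * real p" if "y \<in> F - B" for y
    proof -
      have "real (card (Fp_units p - pinned_dist p y E)) + 1 \<le> \<eta>' p * real p"
        using that p0 by (simp add: B_def \<eta>'_def distrib_right not_less)
      then show ?thesis using card_pinned_dist_deviation[OF p0] by (rule order_trans[rotated])
    qed
    ultimately show ?thesis by blast
  qed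
  show ?thesis
  proof (rule exI[of _ \<eta>], rule exI[of _ \<eta>'], intro conjI \<eta> \<eta>' allI impI)
    fix \<Lambda> p E F
    assume \<Lambda>: "\<forall>p \<theta>. prime p \<and> p \<ge> p\<^sub>3 \<and> 0 \<le> \<theta> \<and> \<theta> \<le> 4 \<longrightarrow> (SUP j\<in>Fp_units p. Lambda_S p j \<theta>) \<le> \<Lambda> \<theta>"
      and "prime p \<and> odd p \<and> E \<subseteq> Fp4 p \<and> F \<subseteq> Fp4 p \<and>
         (\<exists>\<theta>. 0 \<le> \<theta> \<and> \<theta> \<le> 4 \<and> 1 \<le> card F \<and> real (card F) \<le> real p powr \<theta> \<and>
            real (card E) * real (card F) \<ge> real p powr (4 + 2 * \<Lambda> \<theta> + \<epsilon>))"
    then obtain \<theta> where hyps: "prime p" "odd p" "E \<subseteq> Fp4 p" "F \<subseteq> Fp4 p" "1 \<le> card F" "real (card F) \<le> real p powr \<theta>"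
      "0 \<le> \<theta>" "\<theta> \<le> 4" "real p powr (4 + 2 * \<Lambda> \<theta> + \<epsilon>) \<le> real (card E) * real (card F)"
      by (elim conjE exE)
    show "\<exists>F'\<subseteq>F. \<bar>real (card F') - real (card F)\<bar> \<le> \<eta> p * real (card F) \<and>
      (\<forall>y\<in>F'. \<bar>real (card (pinned_dist p y E)) - real p\<bar> \<le> \<eta>' p * real p)"
      by (rule main[OF \<Lambda> hyps])
  qed
qed

end
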